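(* Let $G$ and $H$ be two independent Erdős–Rényi graphs $G(n,p)$ on $n$ vertices with attachment probability $p\in(0,1)$, let $k$ be a positive integer, let $Z_k$ be the number of $k$-cliques in $G\times H$ and let $X_k$ be the number of $k$-cliques in $G$. Then $$\mathbb{E}[Z_k] = k!\binom{n}{k}^2 p^{k(k-1)},$$ and $$\mathrm{Var}(Z_k) = (k!)^2\left((\mathrm{Var}(X_k))^2 + 2\,\mathrm{Var}(X_k)\,(\mathbb{E}[X_k])^2\right).$$
   Context: An Erdős–Rényi graph $G(n,p)$ is a random simple graph on vertex set $\{1,\dots,n\}$ in which each of the $\binom{n}{2}$ possible edges is present independently with probability $p$. A $k$-clique is a set of $k$ pairwise adjacent vertices. The tensor product $G\times H$ of graphs $G=(V_1,E_1)$, $H=(V_2,E_2)$ has vertex set $V_1\times V_2$, with $(v_1,v_2)$ adjacent to $(v_1',v_2')$ if and only if $v_1v_1'\in E_1$ and $v_2v_2'\in E_2$. *)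

theory Defs
  imports "HOL-Probability.Probability" "Graph_Theory.Pair_Digraph"
begin

text \<open>
  Simple graphs are the symmetric loop-free digraphs \<^locale>\<open>pair_graph\<close>: the edge \<open>uv\<close> is
  represented by the two arcs \<open>(u, v)\<close> and \<open>(v, u)\<close>.
\<close>

definition cliques :: "'a pair_pre_digraph \<Rightarrow> nat \<Rightarrow> 'a set set" where
  "cliques G k = {C. C \<subseteq> pverts G \<and> finite C \<and> card C = k \<and>
     (\<forall>u\<in>C. \<forall>v\<in>C. u \<noteq> v \<longrightarrow> (u, v) \<in> parcs G)}"

definition tensor_product ::
  "'a pair_pre_digraph \<Rightarrow> 'b pair_pre_digraph \<Rightarrow> ('a \<times> 'b) pair_pre_digraph" where
  "tensor_product G H = \<lparr>
     pverts = pverts G \<times> pverts H,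
     parcs = {((v1, v2), (v1', v2')) | v1 v2 v1' v2'.
                (v1, v1') \<in> parcs G \<and> (v2, v2') \<in> parcs H}\<rparr>"

text \<open>
  \<open>erdos_renyi n p G\<close>: the random element \<open>G\<close> of the space \<open>M\<close> is a random graph \<open>G(n,p)\<close>.
  The potential edges \<open>ij\<close> are indexed by the pairs with \<open>i < j\<close>, so each is counted once.
\<close>

definition (in prob_space) erdos_renyi ::
  "nat \<Rightarrow> real \<Rightarrow> ('a \<Rightarrow> nat pair_pre_digraph) \<Rightarrow> bool" where
  "erdos_renyi n p G \<longleftrightarrow>
     (\<forall>\<omega>\<in>space M. pair_graph (G \<omega>) \<and> pverts (G \<omega>) = {1..n}) \<and>
     indep_events (\<lambda>e. {\<omega> \<in> space M. e \<in> parcs (G \<omega>)})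
       {(i, j). i \<in> {1..n} \<and> j \<in> {1..n} \<and> i < j} \<and>
     (\<forall>i\<in>{1..n}. \<forall>j\<in>{1..n}. i < j \<longrightarrow>
        prob {\<omega> \<in> space M. (i, j) \<in> parcs (G \<omega>)} = p)"

end

theory Submission
  imports Defs
begin

text \<open>
  Since the factors are loop-free, a \<open>k\<close>-clique of \<open>G \<times> H\<close> is exactly the graph of a bijection
  from a \<open>k\<close>-clique of \<open>G\<close> onto a \<open>k\<close>-clique of \<open>H\<close>, so \<open>Z = k! X Y\<close>, where \<open>Y\<close> counts the
  \<open>k\<close>-cliques of \<open>H\<close>. The first two moments of a clique count depend only on \<open>n\<close>, \<open>p\<close> and \<open>k\<close>,
  so those of \<open>X\<close> and \<open>Y\<close> agree; as \<open>X\<close> and \<open>Y\<close> are also independent, both formulas follow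
  from \<open>E[Z] = k! E[X] E[Y]\<close> and \<open>E[Z\<^sup>2] = (k!)\<^sup>2 E[X\<^sup>2] E[Y\<^sup>2]\<close>.
\<close>

section \<open>Cliques of a tensor product\<close>

lemma card_inj_extensional_funcset:
  assumes "finite A" "finite B" "card A = k" "card B = k"
  shows "card {f \<in> A \<rightarrow>\<^sub>E B. inj_on f A} = fact k"
proof -
  have "card {f \<in> A \<rightarrow>\<^sub>E B. inj_on f A} = prod ((-) k) {0..<k}"
    using card_inj_on_subset_funcset[OF assms(1,2) subset_refl] assms(3,4) by simp
  then show ?thesis
    by (simp add: fact_prod_rev)
qed

lemma in_parcs_tensor_product:
  "(x, y) \<in> parcs (tensor_product G H) \<longleftrightarrow>
     (fst x, fst y) \<in> parcs G \<and> (snd x, snd y) \<in> parcs H"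
  by (cases x; cases y) (auto simp: tensor_product_def)

lemma pverts_tensor_product: "pverts (tensor_product G H) = pverts G \<times> pverts H"
  by (simp add: tensor_product_def)

lemma inj_on_card_eq_image:
  assumes "inj_on f A" "f ` A \<subseteq> B" "finite B" "card A = card B"
  shows "f ` A = B"
  using assms by (metis card_image card_subset_eq)

lemma finite_cliques: "finite (pverts G) \<Longrightarrow> finite (cliques G k)"
  by (rule finite_subset[of _ "Pow (pverts G)"]) (auto simp: cliques_def)

text \<open>Two distinct vertices of \<open>C\<close> are joined by an arc in both coordinates, and
  a loop-free factor has no arc from a vertex to itself. So the two vertices differ in both
  coordinates, and each projection keeps the size and the pairwise adjacency of
  \<open>C\<close>.\<close>

lemma cliques_tensor_product_projections:
  assumes "pair_loopfree_digraph G" "pair_loopfree_digraph H"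
    and C: "C \<in> cliques (tensor_product G H) k"
  shows "inj_on fst C" "inj_on snd C" "fst ` C \<in> cliques G k" "snd ` C \<in> cliques H k"
proof -
  interpret G: pair_loopfree_digraph G by fact
  interpret H: pair_loopfree_digraph H by fact
  have adj: "(fst x, fst y) \<in> parcs G" "(snd x, snd y) \<in> parcs H"
    if "x \<in> C" "y \<in> C" "x \<noteq> y" for x y
    using C that by (auto simp: cliques_def in_parcs_tensor_product)
  show inj: "inj_on fst C" "inj_on snd C"
    using adj G.no_loops' H.no_loops' by (meson inj_onI)+
  have "C \<subseteq> pverts G \<times> pverts H" "finite C" "card C = k"
    using C by (auto simp: cliques_def pverts_tensor_product)
  moreover have "(u, v) \<in> parcs G" if "u \<in> fst ` C" "v \<in> fst ` C" "u \<noteq> v" for u v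
    using that adj(1) by (elim imageE) metis
  moreover have "(u, v) \<in> parcs H" if "u \<in> snd ` C" "v \<in> snd ` C" "u \<noteq> v" for u v
    using that adj(2) by (elim imageE) metis
  ultimately show "fst ` C \<in> cliques G k" "snd ` C \<in> cliques H k"
    using card_image[OF inj(1)] card_image[OF inj(2)]
    unfolding cliques_def by auto
qed

text \<open>Injectivity of \<open>f\<close> turns distinct vertices of \<open>A\<close> into
  distinct vertices of \<open>B\<close>, so that the clique \<open>B\<close> supplies the arc in the
  second coordinate.\<close>

lemma graph_in_cliques_tensor_product:
  assumes A: "A \<in> cliques G k" and B: "B \<in> cliques H k"
    and f: "f ` A \<subseteq> B" "inj_on f A"
  shows "(\<lambda>a. (a, f a)) ` A \<in> cliques (tensor_product G H) k"
proof -
  have "inj_on (\<lambda>a. (a, f a)) A"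
    by (auto intro: inj_onI)
  then have "card ((\<lambda>a. (a, f a)) ` A) = k"
    using A by (simp add: card_image cliques_def)
  moreover have "(u, v) \<in> parcs G \<and> (f u, f v) \<in> parcs H"
    if "u \<in> A" "v \<in> A" "u \<noteq> v" for u v
  proof -
    have "f u \<in> B" "f v \<in> B" "f u \<noteq> f v"
      using that f by (auto dest: inj_onD)
    then show ?thesis
      using that A B by (simp add: cliques_def)
  qed
  ultimately show ?thesis
    using A B f(1) by (auto simp: cliques_def in_parcs_tensor_product pverts_tensor_product)
qed

text \<open>Cliques of the product correspond bijectively to triples of a clique \<open>A\<close> of
  \<open>G\<close>, a clique \<open>B\<close> of \<open>H\<close> and an injection from
  \<open>A\<close> to \<open>B\<close>; each pair \<open>(A, B)\<close> admits \<open>fact k\<close>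
  injections.\<close>

lemma card_cliques_tensor_product:
  assumes "pair_digraph G" "pair_digraph H"
  shows "card (cliques (tensor_product G H) k) =
    fact k * card (cliques G k) * card (cliques H k)"
proof -
  interpret G: pair_digraph G by fact
  interpret H: pair_digraph H by fact
  \<comment> \<open>Extensional functions are fixed outside \<open>A\<close>, so a function is
    determined by its graph over \<open>A\<close>; without this, \<open>gr\<close> below would not
    be injective.\<close>
  define F where "F = (\<lambda>(A :: 'a set, B :: 'b set). {f \<in> A \<rightarrow>\<^sub>E B. inj_on f A})"
  define S where "S = Sigma (cliques G k \<times> cliques H k) F"
  define gr :: "('a set \<times> 'b set) \<times> ('a \<Rightarrow> 'b) \<Rightarrow> ('a \<times> 'b) set"
    where "gr = (\<lambda>((A, B), f). (\<lambda>a. (a, f a)) ` A)"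
  have S_iff: "((A, B), f) \<in> S \<longleftrightarrow>
      A \<in> cliques G k \<and> B \<in> cliques H k \<and> f \<in> A \<rightarrow>\<^sub>E B \<and> inj_on f A" for A B f
    by (simp add: S_def F_def)
  have fst_gr: "fst ` gr ((A, B), f) = A" for A B f
    by (simp add: gr_def image_image)
  have snd_gr: "snd ` gr ((A, B), f) = B" if "((A, B), f) \<in> S" for A B f
  proof -
    \<comment> \<open>An injection between finite sets of the same size \<open>k\<close> is
      onto.\<close>
    have "f ` A = B"
      by (rule inj_on_card_eq_image) (use that in \<open>auto simp: S_iff cliques_def\<close>)
    then show ?thesis
      by (simp add: gr_def image_image)
  qed
  have "inj_on gr S"
  proof (rule inj_onI)
    fix x y assume "x \<in> S" "y \<in> S" "gr x = gr y"
    moreover obtain A B f A' B' f' where xy: "x = ((A, B), f)" "y = ((A', B'), f')"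
      by (metis surj_pair)
    ultimately have S: "((A, B), f) \<in> S" "((A', B'), f') \<in> S"
      and eq: "gr ((A, B), f) = gr ((A', B'), f')"
      by simp_all
    have "A = A'" "B = B'"
      using fst_gr[of A B f] fst_gr[of A' B' f'] snd_gr[OF S(1)] snd_gr[OF S(2)] eq by simp_all
    moreover have "f = f'"
    proof (rule PiE_ext)
      show "f \<in> A \<rightarrow>\<^sub>E B" "f' \<in> A \<rightarrow>\<^sub>E B"
        using S \<open>A = A'\<close> \<open>B = B'\<close> by (auto simp: S_iff)
      show "f a = f' a" if "a \<in> A" for a
        using that eq by (auto simp: gr_def)
    qed
    ultimately show "x = y"
      by (simp add: xy)
  qed
  moreover have "gr ` S = cliques (tensor_product G H) k"
  proof
    show "gr ` S \<subseteq> cliques (tensor_product G H) k"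
      by (auto simp: gr_def S_iff image_subset_iff_funcset PiE_iff
          intro!: graph_in_cliques_tensor_product)
    show "cliques (tensor_product G H) k \<subseteq> gr ` S"
    proof
      fix C assume C: "C \<in> cliques (tensor_product G H) k"
      note proj = cliques_tensor_product_projections
          [OF G.pair_loopfree_digraph_axioms H.pair_loopfree_digraph_axioms C]
      \<comment> \<open>Since \<open>fst\<close> is injective on \<open>C\<close>, each first
        coordinate has exactly one partner; \<open>f\<close> sends it to that partner, and
        \<open>restrict\<close> makes \<open>f\<close> extensional.\<close>
      define f where "f = restrict (\<lambda>a. snd (the_inv_into C fst a)) (fst ` C)"
      have f: "f (fst x) = snd x" if "x \<in> C" for x
        using that by (simp add: f_def the_inv_into_f_f[OF proj(1)])
      have "f \<in> fst ` C \<rightarrow>\<^sub>E snd ` C"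
        using f by (intro PiE_I) (auto simp: f_def)
      moreover have "inj_on f (fst ` C)"
        using f proj(2) by (simp add: inj_on_def) metis
      ultimately have "((fst ` C, snd ` C), f) \<in> S"
        using proj(3,4) by (simp add: S_iff)
      moreover have "gr ((fst ` C, snd ` C), f) = C"
        using f by (simp add: gr_def image_image)
      ultimately show "C \<in> gr ` S"
        by (metis imageI)
    qed
  qed
  ultimately have "card (cliques (tensor_product G H) k) = card S"
    using card_image by metis
  also have "\<dots> = (\<Sum>P\<in>cliques G k \<times> cliques H k. card (F P))"
    unfolding S_def
  proof (rule card_SigmaI)
    show "finite (cliques G k \<times> cliques H k)"
      by (simp add: finite_cliques G.pair_finite_verts H.pair_finite_verts)
    show "\<forall>P\<in>cliques G k \<times> cliques H k. finite (F P)"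
      by (auto simp: F_def cliques_def finite_PiE)
  qed
  also have "\<dots> = (\<Sum>P\<in>cliques G k \<times> cliques H k. fact k)"
    by (intro sum.cong refl)
      (auto simp: F_def cliques_def intro!: card_inj_extensional_funcset)
  finally show ?thesis
    by (simp add: card_cartesian_product)
qed

section \<open>Edge sets of complete graphs\<close>

text \<open>The edges of the complete graph on \<open>S\<close>, each listed once, in the same
  orientation as the index set of the independent events in \<open>erdos_renyi\<close>.\<close>

definition increasing_pairs :: "'a::linorder set \<Rightarrow> ('a \<times> 'a) set" where
  "increasing_pairs S = {(i, j). i \<in> S \<and> j \<in> S \<and> i < j}"

lemma finite_increasing_pairs: "finite S \<Longrightarrow> finite (increasing_pairs S)"
  by (rule finite_subset[of _ "S \<times> S"]) (auto simp: increasing_pairs_def)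

lemma increasing_pairs_mono: "S \<subseteq> T \<Longrightarrow> increasing_pairs S \<subseteq> increasing_pairs T"
  by (auto simp: increasing_pairs_def)

text \<open>The square \<open>S \<times> S\<close> splits into the increasing pairs, their mirror
  images and the diagonal. The doubled form avoids division on \<open>nat\<close>.\<close>

lemma card_increasing_pairs:
  assumes "finite S"
  shows "2 * card (increasing_pairs S) = card S * (card S - 1)"
proof -
  let ?E = "increasing_pairs S"
  have "S \<times> S = (?E \<union> prod.swap ` ?E) \<union> (\<lambda>i. (i, i)) ` S"
    by (auto simp: increasing_pairs_def image_iff neq_iff)
  also have "card \<dots> = card (?E \<union> prod.swap ` ?E) + card ((\<lambda>i. (i, i)) ` S)"
    by (rule card_Un_disjoint)
      (auto simp: finite_increasing_pairs assms, auto simp: increasing_pairs_def)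
  also have "card (?E \<union> prod.swap ` ?E) = card ?E + card (prod.swap ` ?E)"
    by (rule card_Un_disjoint)
      (auto simp: finite_increasing_pairs assms, auto simp: increasing_pairs_def)
  also have "card (prod.swap ` ?E) = card ?E"
    by (simp add: card_image)
  also have "card ((\<lambda>i. (i, i)) ` S) = card S"
    by (simp add: card_image inj_on_def)
  finally show ?thesis
    by (simp add: card_cartesian_product diff_mult_distrib2)
qed

text \<open>Arcs are symmetric, so adjacency need only be tested on pairs in increasing order. This
  makes being a clique a condition on the independent edge events.\<close>

lemma cliques_eq_increasing_pairs:
  fixes G :: "'a::linorder pair_pre_digraph"
  assumes "pair_graph G"
  shows "cliques G k = {S. S \<subseteq> pverts G \<and> card S = k \<and> increasing_pairs S \<subseteq> parcs G}"
proof -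
  interpret pair_graph G by fact
  have "(\<forall>u\<in>S. \<forall>v\<in>S. u \<noteq> v \<longrightarrow> (u, v) \<in> parcs G) \<longleftrightarrow> increasing_pairs S \<subseteq> parcs G" for S
    using arcs_symmetric by (fastforce simp: increasing_pairs_def neq_iff)
  moreover have "finite S" if "S \<subseteq> pverts G" for S
    using that pair_finite_verts by (rule finite_subset)
  ultimately show ?thesis
    by (auto simp: cliques_def)
qed

section \<open>Moments of the clique count of an Erdos-Renyi graph\<close>

context prob_space
begin

lemma erdos_renyi_arcs:
  assumes "erdos_renyi n p G" and F: "F \<subseteq> increasing_pairs {1..n}"
  shows "{\<omega> \<in> space M. F \<subseteq> parcs (G \<omega>)} \<in> events"
    and "prob {\<omega> \<in> space M. F \<subseteq> parcs (G \<omega>)} = p ^ card F"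
proof -
  define A where "A = (\<lambda>e. {\<omega> \<in> space M. e \<in> parcs (G \<omega>)})"
  have indep: "indep_events A (increasing_pairs {1..n})"
    and prob_A: "\<And>e. e \<in> increasing_pairs {1..n} \<Longrightarrow> prob (A e) = p"
    using assms(1) by (auto simp: erdos_renyi_def increasing_pairs_def A_def)
  have "finite F"
    using F finite_increasing_pairs by (rule finite_subset) simp
  have "{\<omega> \<in> space M. F \<subseteq> parcs (G \<omega>)} \<in> events \<and>
      prob {\<omega> \<in> space M. F \<subseteq> parcs (G \<omega>)} = p ^ card F"
  \<comment> \<open>The product rule in \<open>indep_events\<close> covers nonempty finite index
    sets only, and the intersection of an empty family would be \<open>UNIV\<close> instead of
    \<open>space M\<close>.\<close>
  proof (cases "F = {}")
    case True
    then show ?thesis by (simp add: prob_space)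
  next
    case False
    then have eq: "{\<omega> \<in> space M. F \<subseteq> parcs (G \<omega>)} = (\<Inter>e\<in>F. A e)"
      by (auto simp: A_def)
    have "(\<Inter>e\<in>F. A e) \<in> events"
      using False \<open>finite F\<close> indep F
      by (intro sets.finite_INT) (auto simp: indep_events_def)
    moreover have "prob (\<Inter>e\<in>F. A e) = (\<Prod>e\<in>F. prob (A e))"
      using False \<open>finite F\<close> indep F by (simp add: indep_events_def)
    moreover have "(\<Prod>e\<in>F. prob (A e)) = (\<Prod>e\<in>F. p)"
      using F by (intro prod.cong refl prob_A) auto
    ultimately show ?thesis
      using eq by simp
  qed
  then show "{\<omega> \<in> space M. F \<subseteq> parcs (G \<omega>)} \<in> events"
    and "prob {\<omega> \<in> space M. F \<subseteq> parcs (G \<omega>)} = p ^ card F" by simp_all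
qed

lemma erdos_renyi_card_cliques:
  assumes "erdos_renyi n p G" and "\<omega> \<in> space M"
  shows "real (card (cliques (G \<omega>) k)) = (\<Sum>S | S \<subseteq> {1..n} \<and> card S = k.
    indicator {\<omega> \<in> space M. increasing_pairs S \<subseteq> parcs (G \<omega>)} \<omega>)"
proof -
  have "pair_graph (G \<omega>)" "pverts (G \<omega>) = {1..n}"
    using assms by (auto simp: erdos_renyi_def)
  then have "cliques (G \<omega>) k =
      {S. S \<subseteq> {1..n} \<and> card S = k} \<inter> {S. increasing_pairs S \<subseteq> parcs (G \<omega>)}"
    by (auto simp: cliques_eq_increasing_pairs)
  then show ?thesis
    using assms(2) by (simp add: indicator_def sum.If_cases)
qed

text \<open>The product of two indicators is the indicator of the intersection: all edges within
  \<open>S\<close> and all edges within \<open>T\<close> are present. Taking the union counts shared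
  edges once.\<close>

lemma erdos_renyi_card_cliques_square:
  assumes "erdos_renyi n p G" and "\<omega> \<in> space M"
  shows "(real (card (cliques (G \<omega>) k)))\<^sup>2 =
    (\<Sum>S | S \<subseteq> {1..n} \<and> card S = k. \<Sum>T | T \<subseteq> {1..n} \<and> card T = k.
       indicator {\<omega> \<in> space M. increasing_pairs S \<union> increasing_pairs T \<subseteq> parcs (G \<omega>)} \<omega>)"
  unfolding erdos_renyi_card_cliques[OF assms] power2_eq_square sum_product
  by (intro sum.cong refl) (auto simp: indicator_def)

text \<open>Linearity of expectation over the candidate sets \<open>S\<close>. The right-hand side
  does not mention \<open>G\<close>, so any two graphs with the same \<open>n\<close> and
  \<open>p\<close> share this moment.\<close>

lemma erdos_renyi_card_cliques_first_moment:
  assumes "erdos_renyi n p G"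
  shows "integrable M (\<lambda>\<omega>. real (card (cliques (G \<omega>) k)))"
    and "expectation (\<lambda>\<omega>. real (card (cliques (G \<omega>) k))) =
      (\<Sum>S | S \<subseteq> {1..n} \<and> card S = k. p ^ card (increasing_pairs S))"
proof -
  let ?A = "\<lambda>S. {\<omega> \<in> space M. increasing_pairs S \<subseteq> parcs (G \<omega>)}"
  let ?f = "\<lambda>\<omega>. \<Sum>S | S \<subseteq> {1..n} \<and> card S = k. indicator (?A S) \<omega> :: real"
  note A = erdos_renyi_arcs[OF assms increasing_pairs_mono]
  have int: "integrable M (indicator (?A S) :: _ \<Rightarrow> real)" if "S \<subseteq> {1..n}" for S
    using A(1)[OF that] by (simp add: integrable_indicator_iff emeasure_eq_measure)
  have "integrable M ?f"
    using int by auto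
  then show "integrable M (\<lambda>\<omega>. real (card (cliques (G \<omega>) k)))"
    using erdos_renyi_card_cliques[OF assms] by (simp cong: Bochner_Integration.integrable_cong)
  have "expectation (\<lambda>\<omega>. real (card (cliques (G \<omega>) k))) = expectation ?f"
    using erdos_renyi_card_cliques[OF assms] by (intro Bochner_Integration.integral_cong) auto
  also have "\<dots> = (\<Sum>S | S \<subseteq> {1..n} \<and> card S = k. expectation (indicator (?A S)))"
    using int by (intro Bochner_Integration.integral_sum) auto
  also have "\<dots> = (\<Sum>S | S \<subseteq> {1..n} \<and> card S = k. p ^ card (increasing_pairs S))"
    using A by (intro sum.cong refl) (simp add: Int_absorb1)
  finally show "expectation (\<lambda>\<omega>. real (card (cliques (G \<omega>) k))) =
    (\<Sum>S | S \<subseteq> {1..n} \<and> card S = k. p ^ card (increasing_pairs S))" .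
qed

text \<open>The double sum depends on how \<open>S\<close> and \<open>T\<close> overlap and is left
  unevaluated: it serves only to show that the second moments for \<open>G\<close> and
  \<open>H\<close> agree.\<close>

lemma erdos_renyi_card_cliques_second_moment:
  assumes "erdos_renyi n p G"
  shows "integrable M (\<lambda>\<omega>. (real (card (cliques (G \<omega>) k)))\<^sup>2)"
    and "expectation (\<lambda>\<omega>. (real (card (cliques (G \<omega>) k)))\<^sup>2) =
      (\<Sum>S | S \<subseteq> {1..n} \<and> card S = k. \<Sum>T | T \<subseteq> {1..n} \<and> card T = k.
         p ^ card (increasing_pairs S \<union> increasing_pairs T))"
proof -
  let ?K = "{S. S \<subseteq> {1..n} \<and> card S = k}"
  let ?A = "\<lambda>S T. {\<omega> \<in> space M. increasing_pairs S \<union> increasing_pairs T \<subseteq> parcs (G \<omega>)}"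
  let ?f = "\<lambda>\<omega>. \<Sum>S\<in>?K. \<Sum>T\<in>?K. indicator (?A S T) \<omega> :: real"
  note A = erdos_renyi_arcs[OF assms Un_least[OF increasing_pairs_mono increasing_pairs_mono]]
  have int: "integrable M (indicator (?A S T) :: _ \<Rightarrow> real)"
    if "S \<subseteq> {1..n}" "T \<subseteq> {1..n}" for S T
    using A(1)[OF that] by (simp add: integrable_indicator_iff emeasure_eq_measure)
  have "integrable M ?f"
    using int by (intro Bochner_Integration.integrable_sum) blast
  then show "integrable M (\<lambda>\<omega>. (real (card (cliques (G \<omega>) k)))\<^sup>2)"
    using erdos_renyi_card_cliques_square[OF assms]
    by (simp cong: Bochner_Integration.integrable_cong)
  have "expectation (\<lambda>\<omega>. (real (card (cliques (G \<omega>) k)))\<^sup>2) = expectation ?f"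
    using erdos_renyi_card_cliques_square[OF assms]
    by (intro Bochner_Integration.integral_cong) auto
  also have "\<dots> = (\<Sum>S\<in>?K. expectation (\<lambda>\<omega>. \<Sum>T\<in>?K. indicator (?A S T) \<omega>))"
    using int by (intro Bochner_Integration.integral_sum Bochner_Integration.integrable_sum) blast
  also have "\<dots> = (\<Sum>S\<in>?K. \<Sum>T\<in>?K. expectation (indicator (?A S T)))"
    using int by (intro sum.cong refl Bochner_Integration.integral_sum) blast
  also have "\<dots> = (\<Sum>S\<in>?K. \<Sum>T\<in>?K. p ^ card (increasing_pairs S \<union> increasing_pairs T))"
  proof (intro sum.cong refl)
    fix S T assume "S \<in> ?K" "T \<in> ?K"
    then show "expectation (indicator (?A S T)) =
        p ^ card (increasing_pairs S \<union> increasing_pairs T)"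
      using A[of S T] by (simp add: sets.Int_space_eq2)
  qed
  finally show "expectation (\<lambda>\<omega>. (real (card (cliques (G \<omega>) k)))\<^sup>2) =
      (\<Sum>S\<in>?K. \<Sum>T\<in>?K. p ^ card (increasing_pairs S \<union> increasing_pairs T))" .
qed

text \<open>Each of the \<open>n choose k\<close> sets has \<open>k * (k - 1) / 2\<close> edges;
  squaring pairs up two such exponents, so the half disappears.\<close>

lemma erdos_renyi_expectation_card_cliques_square:
  assumes "erdos_renyi n p G"
  shows "(expectation (\<lambda>\<omega>. real (card (cliques (G \<omega>) k))))\<^sup>2 =
    (real (n choose k))\<^sup>2 * p ^ (k * (k - 1))"
proof -
  have "(p ^ card (increasing_pairs S)) * (p ^ card (increasing_pairs T)) = p ^ (k * (k - 1))"
    if "S \<subseteq> {1..n}" "card S = k" "T \<subseteq> {1..n}" "card T = k" for S T :: "nat set"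
  proof -
    have "finite S" "finite T"
      using that by (auto intro: finite_subset)
    then have "card (increasing_pairs S) + card (increasing_pairs T) = k * (k - 1)"
      using card_increasing_pairs[of S] card_increasing_pairs[of T] that by simp
    then show ?thesis
      by (simp flip: power_add)
  qed
  then have "(expectation (\<lambda>\<omega>. real (card (cliques (G \<omega>) k))))\<^sup>2 =
      (\<Sum>S | S \<subseteq> {1..n} \<and> card S = k. \<Sum>T | T \<subseteq> {1..n} \<and> card T = k. p ^ (k * (k - 1)))"
    unfolding erdos_renyi_card_cliques_first_moment(2)[OF assms] power2_eq_square sum_product
    by (intro sum.cong refl) auto
  then show ?thesis
    using n_subsets[of "{1..n}" k] by (simp add: power2_eq_square)
qed

end

section \<open>Mean and variance for the tensor product\<close>

theorem theorem2p1:
  fixes M :: "'w measure" and n k :: nat and p :: real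
    and G H :: "'w \<Rightarrow> nat pair_pre_digraph" and X Z :: "'w \<Rightarrow> real"
  assumes "prob_space M"
    and "0 < p" and "p < 1" and "k > 0"
    and "prob_space.erdos_renyi M n p G"
    and "prob_space.erdos_renyi M n p H"
    and "prob_space.indep_var M (count_space UNIV) G (count_space UNIV) H"
    and "Z = (\<lambda>\<omega>. real (card (cliques (tensor_product (G \<omega>) (H \<omega>)) k)))"
    and "X = (\<lambda>\<omega>. real (card (cliques (G \<omega>) k)))"
  shows "prob_space.expectation M Z = fact k * (real (n choose k))\<^sup>2 * p ^ (k * (k - 1)) \<and>
         prob_space.variance M Z =
           (fact k)\<^sup>2 * ((prob_space.variance M X)\<^sup>2
             + 2 * prob_space.variance M X * (prob_space.expectation M X)\<^sup>2)"
proof -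
  interpret prob_space M by fact
  define Y where "Y = (\<lambda>\<omega>. real (card (cliques (H \<omega>) k)))"
  note ER = \<open>erdos_renyi n p G\<close> \<open>erdos_renyi n p H\<close>
  note X = \<open>X = _\<close>
  note m1 = erdos_renyi_card_cliques_first_moment[where k = k]
    and m2 = erdos_renyi_card_cliques_second_moment[where k = k]
  have intX: "integrable M X" "integrable M (\<lambda>\<omega>. (X \<omega>)\<^sup>2)"
    and intY: "integrable M Y" "integrable M (\<lambda>\<omega>. (Y \<omega>)\<^sup>2)"
    using m1(1)[OF ER(1)] m2(1)[OF ER(1)] m1(1)[OF ER(2)] m2(1)[OF ER(2)]
    by (simp_all add: X Y_def)
  have EY: "expectation Y = expectation X"
    and EY2: "expectation (\<lambda>\<omega>. (Y \<omega>)\<^sup>2) = expectation (\<lambda>\<omega>. (X \<omega>)\<^sup>2)"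
    using m1(2)[OF ER(1)] m1(2)[OF ER(2)] m2(2)[OF ER(1)] m2(2)[OF ER(2)]
    by (simp_all add: X Y_def)
  let ?c = "\<lambda>K :: nat pair_pre_digraph. real (card (cliques K k))"
  \<comment> \<open>Every function on \<open>count_space UNIV\<close> is measurable, so independence
    passes to any function of the counts. A general \<open>g\<close> covers both the counts and
    their squares.\<close>
  have indep: "indep_var borel (\<lambda>\<omega>. g (?c (G \<omega>))) borel (\<lambda>\<omega>. g (?c (H \<omega>)))"
    for g :: "real \<Rightarrow> real"
    using indep_var_compose[OF \<open>indep_var _ G _ H\<close>,
        of "\<lambda>K. g (?c K)" borel "\<lambda>K. g (?c K)" borel]
    by (simp add: comp_def)
  have indep1: "indep_var borel X borel Y"
    using indep[of "\<lambda>x. x"] by (simp add: X Y_def)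
  have indep2: "indep_var borel (\<lambda>\<omega>. (X \<omega>)\<^sup>2) borel (\<lambda>\<omega>. (Y \<omega>)\<^sup>2)"
    using indep[of "\<lambda>x. x\<^sup>2"] by (simp add: X Y_def)
  have intXY: "integrable M (\<lambda>\<omega>. X \<omega> * Y \<omega>)" "integrable M (\<lambda>\<omega>. (X \<omega>)\<^sup>2 * (Y \<omega>)\<^sup>2)"
    using indep_var_integrable[OF indep1 intX(1) intY(1)]
      indep_var_integrable[OF indep2 intX(2) intY(2)] by simp_all
  have EXY: "expectation (\<lambda>\<omega>. X \<omega> * Y \<omega>) = (expectation X)\<^sup>2"
    and EXY2: "expectation (\<lambda>\<omega>. (X \<omega>)\<^sup>2 * (Y \<omega>)\<^sup>2) = (expectation (\<lambda>\<omega>. (X \<omega>)\<^sup>2))\<^sup>2"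
    using indep_var_lebesgue_integral[OF indep1 intX(1) intY(1)]
      indep_var_lebesgue_integral[OF indep2 intX(2) intY(2)]
    by (simp_all add: EY EY2 power2_eq_square[of "expectation _"])
  \<comment> \<open>\<open>erdos_renyi\<close> constrains the graphs on \<open>space M\<close> only,
    so the identity holds there, which suffices for integrals.\<close>
  have Z: "Z \<omega> = fact k * (X \<omega> * Y \<omega>)" if "\<omega> \<in> space M" for \<omega>
  proof -
    have "pair_graph (G \<omega>)" "pair_graph (H \<omega>)"
      using ER that by (auto simp: erdos_renyi_def)
    then have "pair_digraph (G \<omega>)" "pair_digraph (H \<omega>)"
      by (auto simp: pair_graph_def)
    then show ?thesis
      using card_cliques_tensor_product[of "G \<omega>" "H \<omega>" k]
      by (simp add: \<open>Z = _\<close> X Y_def)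
  qed
  have intZ: "integrable M Z" "integrable M (\<lambda>\<omega>. (Z \<omega>)\<^sup>2)"
    using intXY Z by (simp_all add: power_mult_distrib cong: Bochner_Integration.integrable_cong)
  have "expectation Z = expectation (\<lambda>\<omega>. fact k * (X \<omega> * Y \<omega>))"
    using Z by (intro Bochner_Integration.integral_cong) auto
  then have EZ: "expectation Z = fact k * (expectation X)\<^sup>2"
    by (simp add: EXY)
  have "expectation (\<lambda>\<omega>. (Z \<omega>)\<^sup>2) = expectation (\<lambda>\<omega>. (fact k)\<^sup>2 * ((X \<omega>)\<^sup>2 * (Y \<omega>)\<^sup>2))"
    using Z by (intro Bochner_Integration.integral_cong) (auto simp: power_mult_distrib)
  then have EZ2: "expectation (\<lambda>\<omega>. (Z \<omega>)\<^sup>2) = (fact k)\<^sup>2 * (expectation (\<lambda>\<omega>. (X \<omega>)\<^sup>2))\<^sup>2"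
    by (simp add: EXY2)
  have "variance Z = expectation (\<lambda>\<omega>. (Z \<omega>)\<^sup>2) - (expectation Z)\<^sup>2"
    by (rule variance_eq[OF intZ])
  \<comment> \<open>With \<open>a\<close> the second moment of \<open>X\<close> and \<open>b\<close>
    its squared mean, \<open>variance X\<close> is \<open>a - b\<close>, and the claim is
    \<open>a^2 - b^2 = (a - b)^2 + 2 * (a - b) * b\<close>, scaled by the square of
    \<open>fact k\<close>.\<close>
  also have "\<dots> = (fact k)\<^sup>2 * ((variance X)\<^sup>2 + 2 * variance X * (expectation X)\<^sup>2)"
    unfolding variance_eq[OF intX] EZ EZ2
    by (simp add: algebra_simps power2_eq_square)
  finally have "variance Z =
    (fact k)\<^sup>2 * ((variance X)\<^sup>2 + 2 * variance X * (expectation X)\<^sup>2)" .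
  moreover have "(expectation X)\<^sup>2 = (real (n choose k))\<^sup>2 * p ^ (k * (k - 1))"
    using erdos_renyi_expectation_card_cliques_square[OF ER(1)] by (simp add: X)
  ultimately show ?thesis
    using EZ by simp
qed

end
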